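(* There is an absolute constant $C>0$ such that for all real $x \ge 2$, $$\sum_{n \le x} \#\Psi^*(n) \le C\, x \log x,$$ where the sum is over positive integers $n \le x$.
   Context: $\varphi$ denotes the Euler totient function. For an integer $n \ge 1$, $\Psi(n)$ is the set of all integers $m \ge 1$ with $\varphi(m) = n$, and $\Psi^*(n) = \bigcup_{d \mid n} \Psi(d)$, the union over the positive divisors $d$ of $n$. *)

theory Defs
  imports Complex_Main "HOL-Number_Theory.Totient"
begin

definition Psi :: "nat \<Rightarrow> nat set" where
  "Psi n = {m. m \<ge> 1 \<and> totient m = n}"

text \<open>Only used for \<open>n \<ge> 1\<close>, where every divisor is positive.\<close>

definition Psi_star :: "nat \<Rightarrow> nat set" where
  "Psi_star n = (\<Union>d\<in>{d. d dvd n}. Psi d)"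

text \<open>The sets are finite for \<open>n \<ge> 1\<close>, so \<open>card\<close> on them is the true cardinality.\<close>

lemma finite_Psi:
  assumes "n \<ge> 1"
  shows "finite (Psi n)"
proof -
  have "m dvd fact (n + 1) ^ (n + 1)" if m: "m \<in> Psi n" for m
  proof (rule multiplicity_le_imp_dvd)
    from m show "m \<noteq> 0" by (auto simp: Psi_def)
    fix p :: nat assume p: "prime p"
    show "multiplicity p m \<le> multiplicity p (fact (n + 1) ^ (n + 1) :: nat)"
    proof (cases "multiplicity p m")
      case (Suc k)
      have "p ^ Suc k dvd m" using multiplicity_dvd[of p m] Suc by simp
      then have "totient (p ^ Suc k) dvd totient m" by (rule totient_dvd)
      then have d: "p ^ k * (p - 1) dvd n"
        using m p by (simp add: Psi_def totient_prime_power_Suc del: power_Suc)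
      have "p - 1 \<le> n" "p ^ k \<le> n"
        using d assms by (meson dvd_imp_le dvd_mult_left dvd_mult_right less_le_trans zero_less_one)+
      moreover have "k < p ^ k" using prime_gt_1_nat[OF p] by (simp add: power_gt_expt)
      ultimately have "Suc k \<le> n + 1" and "p dvd fact (n + 1)"
        using p prime_dvd_fact_iff[OF p, of "n + 1"] by auto
      then have "p ^ Suc k dvd fact (n + 1) ^ (n + 1)"
        by (meson dvd_power_same dvd_trans le_imp_power_dvd)
      then have "Suc k \<le> multiplicity p (fact (n + 1) ^ (n + 1) :: nat)"
        using p by (intro multiplicity_geI) auto
      then show ?thesis using Suc by simp
    qed simp
  qed
  then have "Psi n \<subseteq> {m. m dvd fact (n + 1) ^ (n + 1)}" by blast
  then show ?thesis by (rule finite_subset) (rule finite_divisors_nat, simp)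
qed

lemma finite_Psi_star:
  assumes "n \<ge> 1"
  shows "finite (Psi_star n)"
  unfolding Psi_star_def
proof (rule finite_UN_I)
  show "finite {d. d dvd n}" using assms by (intro finite_divisors_nat) simp
  fix d assume "d \<in> {d. d dvd n}"
  then have "d \<ge> 1" using assms by (auto intro!: Suc_leI dvd_pos_nat[of n d])
  then show "finite (Psi d)" by (rule finite_Psi)
qed

end

theory Submission
  imports Defs
begin

text \<open>
  Interchanging summation, the left-hand side is at most $x$ times the sum of $1/\varphi(m)$ over
  $\varphi(m) \le x$. For $m \le x$ use $1/\varphi(m) \le (1/m)(m/\varphi(m))^2$; for $m > x$ use
  $1/\varphi(m) \le x/\varphi(m)^2 = (x/m^2)(m/\varphi(m))^2$. Writing
  $(m/\varphi(m))^2$ as a sum of a multiplicative function over the squarefree divisors of $m$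
  shows that the factor $(m/\varphi(m))^2$ costs only a constant on average, so these two parts
  are $O(\log x)$ and $O(1)$.
\<close>

section \<open>Elementary bounds for sums and products\<close>

lemma sum_inverse_squares_le:
  fixes A :: "nat set" and a :: nat
  assumes "a \<ge> 1" "finite A" "\<And>k. k \<in> A \<Longrightarrow> k \<ge> a"
  shows "(\<Sum>k\<in>A. 1 / real k ^ 2) \<le> 2 / real a"
proof -
  obtain b where b: "\<And>k. k \<in> A \<Longrightarrow> k < b" "a \<le> b"
    using \<open>finite A\<close> finite_nat_set_iff_bounded
    by (metis max.cobounded1 max.cobounded2 less_le_trans)
  have tele: "(\<Sum>k\<in>{a..<b}. 1 / real k ^ 2) \<le> 2 / real a - 2 / real b"
    using \<open>a \<le> b\<close>
  proof (induction b rule: dec_induct)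
    case (step n)
    have n: "real n \<ge> 1" using step assms(1) by simp
    \<comment> \<open>Since \<open>n \<ge> 1\<close>, 2n^2 is at least n(n+1), and 2/(n(n+1))
      telescopes; this is where the constant 2 comes from.\<close>
    have "1 / real n ^ 2 = 2 / (2 * real n ^ 2)" by simp
    also have "\<dots> \<le> 2 / (real n * real (Suc n))"
      using n by (intro frac_le) (auto simp: power2_eq_square algebra_simps add_pos_nonneg)
    also have "\<dots> = 2 / real n - 2 / real (Suc n)" using n by (simp add: field_simps)
    finally have "1 / real n ^ 2 \<le> 2 / real n - 2 / real (Suc n)" .
    then show ?case using step by simp
  qed simp
  have "(\<Sum>k\<in>A. 1 / real k ^ 2) \<le> (\<Sum>k\<in>{a..<b}. 1 / real k ^ 2)"
    using b assms by (intro sum_mono2) auto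
  also have "\<dots> \<le> 2 / real a" using tele by (smt (verit) divide_nonneg_nonneg of_nat_0_le_iff)
  finally show ?thesis .
qed

lemma sum_inverse_le_ln:
  assumes "n \<ge> 1"
  shows "(\<Sum>k\<in>{1..n}. 1 / real k) \<le> 1 + ln (real n)"
  using assms
proof (induction n rule: dec_induct)
  case (step n)
  have n: "real n \<ge> 1" using step by simp
  \<comment> \<open>The inequality ln t \<le> t - 1 at t = n/(n+1) bounds the new harmonic term by
    an increment of the logarithm.\<close>
  have "ln (real n / real (Suc n)) \<le> real n / real (Suc n) - 1"
    using n by (intro ln_le_minus_one) simp
  also have "\<dots> = - (1 / real (Suc n))" by (simp add: field_simps)
  finally have "1 / real (Suc n) \<le> ln (real (Suc n)) - ln (real n)"
    using n by (simp add: ln_div)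
  then show ?case using step by simp
qed simp

lemma sum_multiples:
  fixes f :: "nat \<Rightarrow> real" and d :: nat
  assumes "d \<ge> 1"
  shows "(\<Sum>m\<in>{m\<in>A. d dvd m}. f m) = (\<Sum>k\<in>{k. d * k \<in> A}. f (d * k))"
  using assms
  by (intro sum.reindex_bij_witness[of _ "\<lambda>k. d * k" "\<lambda>m. m div d"]) auto

text \<open>Sets of prime factors encode squarefree divisors: each prime in \<open>S\<close> has
  positive exponent in \<open>n\<close>, so the product divides the factorization of
  \<open>n\<close> factor by factor.\<close>

lemma prod_subset_prime_factors_dvd:
  fixes n :: nat
  assumes "n > 0" "S \<subseteq> prime_factors n"
  shows "\<Prod>S dvd n"
proof -
  have "(\<Prod>p\<in>S. p) dvd (\<Prod>p\<in>prime_factors n. p ^ multiplicity p n)"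
    using assms
    by (intro prod_dvd_prod_subset2 finite_set_mset)
       (auto simp: prime_factors_multiplicity intro!: dvd_power)
  also have "\<dots> = n" using assms by (intro prime_factorization_nat[symmetric]) auto
  finally show ?thesis .
qed

lemma prod_one_plus_le_exp_sum:
  fixes f :: "'a \<Rightarrow> real"
  assumes "\<And>x. x \<in> A \<Longrightarrow> f x \<ge> 0"
  shows "(\<Prod>x\<in>A. 1 + f x) \<le> exp (\<Sum>x\<in>A. f x)"
proof (cases "finite A")
  case True
  have "(\<Prod>x\<in>A. 1 + f x) \<le> (\<Prod>x\<in>A. exp (f x))"
    using assms by (intro prod_mono) (auto simp: add_nonneg_nonneg)
  \<comment> \<open>For infinite \<open>A\<close> the product is 1 and the sum is 0 by default, so
    both sides equal 1.\<close>
  with True show ?thesis by (simp add: exp_sum)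
qed simp

section \<open>The mean value of (m/phi(m))^2\<close>

text \<open>The value at a prime \<open>p\<close> of the multiplicative function g, supported on
  squarefree numbers, for which (m/phi(m))^2 is the sum of g(d) over d dividing m.\<close>

definition ratio_coeff :: "nat \<Rightarrow> real" where
  "ratio_coeff p = (real p / (real p - 1)) ^ 2 - 1"

text \<open>Both follow from g(p) = (2p-1)/(p-1)^2. The second bound makes the sum of g(p)/p over
  primes converge; its form in \<open>p - 1\<close> allows comparison with the inverse squares from
  1 on.\<close>

lemma ratio_coeff_bounds:
  assumes "prime p"
  shows "ratio_coeff p \<ge> 0" "ratio_coeff p / real p \<le> 2 * (1 / real (p - 1) ^ 2)"
proof -
  have p: "real p \<ge> 2" using prime_ge_2_nat[OF assms] by simp
  have eq: "ratio_coeff p = (2 * real p - 1) / (real p - 1) ^ 2"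
  proof -
    have "ratio_coeff p = (real p ^ 2 - (real p - 1) ^ 2) / (real p - 1) ^ 2"
      using p by (simp add: ratio_coeff_def power_divide diff_divide_distrib)
    also have "real p ^ 2 - (real p - 1) ^ 2 = 2 * real p - 1"
      by (simp add: power2_eq_square algebra_simps)
    finally show ?thesis .
  qed
  show "ratio_coeff p \<ge> 0" using p by (simp add: eq)
  have "ratio_coeff p / real p = ((2 * real p - 1) / real p) * (1 / (real p - 1) ^ 2)"
    by (simp add: eq)
  also have "\<dots> \<le> 2 * (1 / (real p - 1) ^ 2)"
    using p by (intro mult_right_mono) (auto simp: field_simps)
  also have "real p - 1 = real (p - 1)" using p by (simp add: of_nat_diff)
  finally show "ratio_coeff p / real p \<le> 2 * (1 / real (p - 1) ^ 2)" .
qed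

text \<open>In the Euler product of m/phi(m) the squared factor at p is 1 +
  \<open>ratio_coeff p\<close>; multiplying out gives one term for each set of prime
  factors.\<close>

lemma totient_ratio_expansion:
  assumes "m > 0"
  shows "(real m / real (totient m)) ^ 2 =
         (\<Sum>S\<in>Pow (prime_factors m). \<Prod>p\<in>S. ratio_coeff p)"
proof -
  have "real m / real (totient m) = inverse (\<Prod>p\<in>prime_factors m. 1 - 1 / real p)"
    using assms by (simp add: totient_formula2 field_simps)
  also have "\<dots> = (\<Prod>p\<in>prime_factors m. real p / (real p - 1))"
    unfolding prod_inversef[symmetric] o_def
  proof (intro prod.cong refl)
    fix p assume "p \<in> prime_factors m"
    then have "real p \<ge> 2" using prime_ge_2_nat[of p] by auto
    then show "inverse (1 - 1 / real p) = real p / (real p - 1)" by (simp add: field_simps)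
  qed
  finally have "(real m / real (totient m)) ^ 2 = (\<Prod>p\<in>prime_factors m. ratio_coeff p + 1)"
    by (simp add: ratio_coeff_def prod_power_distrib)
  then show ?thesis by (simp add: prod_add)
qed

text \<open>After expanding the square and swapping sums, a squarefree d contributes at most g(d)
  B/d. Summed over d, this is B times the product of 1 + g(p)/p, which is bounded by an absolute
  constant.\<close>

lemma sum_totient_ratio_le:
  fixes w :: "nat \<Rightarrow> real" and A :: "nat set" and B :: real
  assumes A: "finite A" "\<And>m. m \<in> A \<Longrightarrow> m > 0"
    and w: "\<And>m. m \<in> A \<Longrightarrow> w m \<ge> 0"
    and B: "\<And>d. d \<ge> 1 \<Longrightarrow> (\<Sum>m\<in>{m\<in>A. d dvd m}. w m) \<le> B / real d"
  shows "(\<Sum>m\<in>A. w m * (real m / real (totient m)) ^ 2) \<le> exp 4 * B"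
proof -
  define P where "P = (\<Union>m\<in>A. prime_factors m)"
  define G where "G S = (\<Prod>p\<in>S. ratio_coeff p)" for S
  have fin: "finite P" using A by (auto simp: P_def)
  have prime: "prime p" if "p \<in> P" for p using that by (auto simp: P_def)
  have G: "G S \<ge> 0" if "S \<subseteq> P" for S
    unfolding G_def using that by (intro prod_nonneg) (auto intro: ratio_coeff_bounds prime)
  have "B \<ge> 0" using B[of 1] sum_nonneg[of A w] w by simp
  \<comment> \<open>The exponent 4 is 2 from \<open>ratio_coeff_bounds\<close> times 2 from the
    inverse squares.\<close>
  have "(\<Sum>p\<in>P. ratio_coeff p / real p) \<le> (\<Sum>p\<in>P. 2 * (1 / real (p - 1) ^ 2))"
    by (intro sum_mono ratio_coeff_bounds prime)
  also have "\<dots> = 2 * (\<Sum>k\<in>(\<lambda>p. p - 1) ` P. 1 / real k ^ 2)"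
  proof -
    have "inj_on (\<lambda>p::nat. p - 1) P"
      by (intro inj_onI) (metis Suc_diff_1 prime prime_gt_0_nat)
    then show ?thesis by (simp add: sum.reindex sum_distrib_left)
  qed
  also have "\<dots> \<le> 2 * (2 / real 1)"
  proof (intro mult_left_mono sum_inverse_squares_le)
    fix k assume "k \<in> (\<lambda>p. p - 1) ` P"
    then obtain p where "p \<in> P" "k = p - 1" by auto
    then show "k \<ge> 1" using prime_ge_2_nat[OF prime[of p]] by simp
  qed (use fin in auto)
  finally have "exp (\<Sum>p\<in>P. ratio_coeff p / real p) \<le> exp 4" by simp
  moreover have "(\<Prod>p\<in>P. 1 + ratio_coeff p / real p) \<le> exp (\<Sum>p\<in>P. ratio_coeff p / real p)"
    by (intro prod_one_plus_le_exp_sum divide_nonneg_nonneg ratio_coeff_bounds prime) auto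
  ultimately have euler_prod: "(\<Prod>p\<in>P. 1 + ratio_coeff p / real p) \<le> exp 4" by linarith
  have "(\<Sum>m\<in>A. w m * (real m / real (totient m)) ^ 2) =
        (\<Sum>m\<in>A. w m * (\<Sum>S\<in>Pow (prime_factors m). G S))"
    using A by (intro sum.cong) (auto simp: totient_ratio_expansion G_def)
  \<comment> \<open>The sets \<open>S\<close> now range over a family independent of
    \<open>m\<close>, restricted only by divisibility, so the sums can be swapped; any added terms
    are nonnegative.\<close>
  also have "\<dots> \<le> (\<Sum>m\<in>A. w m * (\<Sum>S\<in>{S\<in>Pow P. \<Prod>S dvd m}. G S))"
  proof (intro sum_mono mult_left_mono sum_mono2)
    fix m assume "m \<in> A"
    then show "Pow (prime_factors m) \<subseteq> {S \<in> Pow P. \<Prod>S dvd m}"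
      using A prod_subset_prime_factors_dvd[of m] by (auto simp: P_def)
  qed (use fin G w in auto)
  also have "\<dots> = (\<Sum>m\<in>A. \<Sum>S\<in>{S\<in>Pow P. \<Prod>S dvd m}. w m * G S)"
    by (simp add: sum_distrib_left)
  also have "\<dots> = (\<Sum>S\<in>Pow P. \<Sum>m\<in>{m\<in>A. \<Prod>S dvd m}. w m * G S)"
    using A fin by (intro sum.swap_restrict) auto
  also have "\<dots> = (\<Sum>S\<in>Pow P. G S * (\<Sum>m\<in>{m\<in>A. \<Prod>S dvd m}. w m))"
    by (simp add: sum_distrib_left mult.commute)
  also have "\<dots> \<le> (\<Sum>S\<in>Pow P. G S * (B / real (\<Prod>S)))"
  proof (intro sum_mono mult_left_mono B)
    fix S assume "S \<in> Pow P"
    then have "\<Prod>S > 0" by (intro prod_pos) (auto intro!: prime_gt_0_nat prime)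
    then show "1 \<le> \<Prod>S" by simp
  qed (use G in auto)
  also have "\<dots> = B * (\<Sum>S\<in>Pow P. \<Prod>p\<in>S. ratio_coeff p / real p)"
    by (simp add: sum_distrib_left G_def prod_dividef mult_ac)
  also have "(\<Sum>S\<in>Pow P. \<Prod>p\<in>S. ratio_coeff p / real p) = (\<Prod>p\<in>P. ratio_coeff p / real p + 1)"
    using fin by (simp add: prod_add)
  also have "\<dots> = (\<Prod>p\<in>P. 1 + ratio_coeff p / real p)" by (simp add: add.commute)
  also have "B * \<dots> \<le> B * exp 4"
    using euler_prod \<open>B \<ge> 0\<close> by (rule mult_left_mono)
  finally show ?thesis by (simp only: mult.commute)
qed

section \<open>Sums of 1/phi(m)\<close>

text \<open>The weights are 1/m: the multiples of d up to N contribute 1/d times part of the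
  harmonic sum up to N, so \<open>B\<close> can be 1 + ln N.\<close>

lemma sum_inverse_totient_small:
  assumes "N \<ge> 1"
  shows "(\<Sum>m\<in>{1..N}. 1 / real (totient m)) \<le> exp 4 * (1 + ln (real N))"
proof -
  have "(\<Sum>m\<in>{1..N}. 1 / real (totient m)) \<le>
        (\<Sum>m\<in>{1..N}. 1 / real m * (real m / real (totient m)) ^ 2)"
  proof (intro sum_mono)
    fix m assume "m \<in> {1..N}"
    then have "real (totient m) > 0" "real (totient m) \<le> real m"
      by (auto simp: totient_le)
    then show "1 / real (totient m) \<le> 1 / real m * (real m / real (totient m)) ^ 2"
      by (simp add: field_simps power2_eq_square)
  qed
  also have "\<dots> \<le> exp 4 * (1 + ln (real N))"
  proof (rule sum_totient_ratio_le)
    fix d :: nat assume d: "d \<ge> 1"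
    have "(\<Sum>m\<in>{m\<in>{1..N}. d dvd m}. 1 / real m) =
          (\<Sum>k\<in>{k. d * k \<in> {1..N}}. 1 / real k) / real d"
      by (simp only: sum_multiples[OF d]) (simp add: sum_divide_distrib mult.commute)
    also have "\<dots> \<le> (\<Sum>k\<in>{1..N}. 1 / real k) / real d"
    proof (intro divide_right_mono sum_mono2 subsetI)
      fix k assume "k \<in> {k. d * k \<in> {1..N}}"
      then have "k \<ge> 1" "d * k \<le> N" by (auto intro: Suc_leI gr0I)
      moreover have "k \<le> d * k" using d by simp
      ultimately show "k \<in> {1..N}" using le_trans atLeastAtMost_iff by blast
    qed auto
    also have "\<dots> \<le> (1 + ln (real N)) / real d"
      using sum_inverse_le_ln[OF assms] by (intro divide_right_mono) auto
    finally show "(\<Sum>m\<in>{m\<in>{1..N}. d dvd m}. 1 / real m) \<le> (1 + ln (real N)) / real d" .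
  qed auto
  finally show ?thesis .
qed

text \<open>The weights are 1/m^2: the multiples of d beyond N form a tail of size at most (2/N)/d,
  and the factor N from phi(m) \<le> N cancels the 1/N.\<close>

lemma sum_inverse_totient_large:
  assumes N: "N \<ge> 1" and A: "finite A" "\<And>m. m \<in> A \<Longrightarrow> m > N \<and> totient m \<le> N"
  shows "(\<Sum>m\<in>A. 1 / real (totient m)) \<le> exp 4 * 2"
proof -
  have "(\<Sum>m\<in>A. 1 / real (totient m)) \<le>
        (\<Sum>m\<in>A. real N * (1 / real m ^ 2 * (real m / real (totient m)) ^ 2))"
  proof (intro sum_mono)
    fix m assume "m \<in> A"
    then have "real m > 0" "real (totient m) > 0" "real (totient m) \<le> real N"
      using A by fastforce+
    then show "1 / real (totient m) \<le>
        real N * (1 / real m ^ 2 * (real m / real (totient m)) ^ 2)"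
      by (simp add: field_simps power2_eq_square)
  qed
  also have "\<dots> = real N * (\<Sum>m\<in>A. 1 / real m ^ 2 * (real m / real (totient m)) ^ 2)"
    by (simp add: sum_distrib_left)
  also have "\<dots> \<le> real N * (exp 4 * (2 / real N))"
  proof (intro mult_left_mono sum_totient_ratio_le)
    fix d :: nat assume d: "d \<ge> 1"
    \<comment> \<open>The least k with dk > N; it is positive even when d > N.\<close>
    define a where "a = N div d + 1"
    have a: "N \<le> d * a"
      using mult_div_mod_eq[of d N] mod_less_divisor[of d N] d unfolding a_def
      by (simp only: distrib_left) linarith
    have "finite {k. d * k \<in> A}"
      using A(1) d by (intro finite_vimageI[of A "\<lambda>k. d * k", unfolded vimage_def]) (auto simp: inj_def)
    then have "(\<Sum>k\<in>{k. d * k \<in> A}. 1 / real k ^ 2) \<le> 2 / real a"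
    proof (rule sum_inverse_squares_le[rotated])
      fix k assume "k \<in> {k. d * k \<in> A}"
      then have "N < k * d" using A by (auto simp: mult.commute)
      then show "a \<le> k" using d by (simp add: a_def div_less_iff_less_mult Suc_le_eq)
    qed (simp add: a_def)
    then have "(\<Sum>k\<in>{k. d * k \<in> A}. 1 / real k ^ 2) / real d ^ 2 \<le> 2 / real a / real d ^ 2"
      by (rule divide_right_mono) simp
    moreover have "(\<Sum>m\<in>{m\<in>A. d dvd m}. 1 / real m ^ 2) =
        (\<Sum>k\<in>{k. d * k \<in> A}. 1 / real k ^ 2) / real d ^ 2"
      by (simp add: sum_multiples[OF d] sum_divide_distrib power_mult_distrib mult.commute)
    ultimately have "(\<Sum>m\<in>{m\<in>A. d dvd m}. 1 / real m ^ 2) \<le> 2 / real a / real d ^ 2"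
      by simp
    also have "\<dots> = 2 / real (d * a) / real d" by (simp add: power2_eq_square mult_ac)
    also have "\<dots> \<le> 2 / real N / real d"
      using a N by (intro divide_right_mono frac_le) (auto simp flip: of_nat_mult)
    finally show "(\<Sum>m\<in>{m\<in>A. d dvd m}. 1 / real m ^ 2) \<le> 2 / real N / real d" .
  qed (use A in fastforce)+
  also have "\<dots> = exp 4 * 2" using N by simp
  finally show ?thesis .
qed

section \<open>Interchange of summation and the final bound\<close>

lemma sum_card_Psi_star_le:
  assumes N: "N \<ge> 1"
  shows "(\<Sum>n\<in>{1..N}. real (card (Psi_star n))) \<le> real N * (exp 4 * (3 + ln (real N)))"
proof -
  define M where "M = (\<Union>d\<in>{1..N}. Psi d)"
  have fin: "finite M" unfolding M_def by (intro finite_UN_I finite_Psi) auto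
  have M: "m \<in> M \<longleftrightarrow> m \<ge> 1 \<and> totient m \<le> N" for m
    by (auto simp: M_def Psi_def Suc_le_eq)
  have "(\<Sum>n\<in>{1..N}. real (card (Psi_star n))) =
        (\<Sum>n\<in>{1..N}. \<Sum>m\<in>{m\<in>M. totient m dvd n}. 1)"
  proof (intro sum.cong refl)
    fix n assume n: "n \<in> {1..N}"
    \<comment> \<open>A divisor of \<open>n\<close> is at most \<open>N\<close>, so the fixed finite
      set \<open>M\<close> serves for every \<open>n\<close>.\<close>
    have "Psi_star n = {m\<in>M. totient m dvd n}"
      using n by (auto simp: M Psi_star_def Psi_def dest: dvd_imp_le)
    then show "real (card (Psi_star n)) = (\<Sum>m\<in>{m\<in>M. totient m dvd n}. 1)" by simp
  qed
  also have "\<dots> = (\<Sum>m\<in>M. \<Sum>n\<in>{n\<in>{1..N}. totient m dvd n}. 1)"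
    using fin by (intro sum.swap_restrict) auto
  also have "\<dots> \<le> (\<Sum>m\<in>M. real N * (1 / real (totient m)))"
  proof (intro sum_mono)
    fix m assume "m \<in> M"
    then have t: "totient m \<ge> 1" by (simp add: M Suc_le_eq)
    have "{k. totient m * k \<in> {1..N}} \<subseteq> {1..N div totient m}"
    proof
      fix k assume "k \<in> {k. totient m * k \<in> {1..N}}"
      then have "k \<ge> 1" "k * totient m \<le> N" by (auto intro: Suc_leI gr0I simp: mult.commute)
      then show "k \<in> {1..N div totient m}" using t
        by (simp add: less_eq_div_iff_mult_less_eq Suc_le_eq)
    qed
    then have "card {k. totient m * k \<in> {1..N}} \<le> N div totient m"
      by (metis card_atLeastAtMost card_mono diff_Suc_1 finite_atLeastAtMost)
    then have "real (card {k. totient m * k \<in> {1..N}}) \<le> real (N div totient m)"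
      by (rule of_nat_mono)
    also have "\<dots> \<le> real N / real (totient m)" by (rule of_nat_div_le_of_nat)
    finally show "(\<Sum>n\<in>{n\<in>{1..N}. totient m dvd n}. 1) \<le> real N * (1 / real (totient m))"
      by (simp only: sum_multiples[OF t]) simp
  qed
  also have "\<dots> = real N * (\<Sum>m\<in>M. 1 / real (totient m))" by (simp add: sum_distrib_left)
  \<comment> \<open>Since phi(m) \<le> m, all of \<open>{1..N}\<close> lies in \<open>M\<close>; the
    two pieces contribute 1 + ln N and 2, hence the 3 in the bound.\<close>
  also have "(\<Sum>m\<in>M. 1 / real (totient m)) =
      (\<Sum>m\<in>{1..N}. 1 / real (totient m)) + (\<Sum>m\<in>{m\<in>M. m > N}. 1 / real (totient m))"
  proof -
    have "M = {1..N} \<union> {m\<in>M. m > N}"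
      by (auto simp: M intro: le_trans[OF totient_le])
    then have "(\<Sum>m\<in>M. 1 / real (totient m)) = (\<Sum>m\<in>{1..N} \<union> {m\<in>M. m > N}. 1 / real (totient m))"
      by simp
    also have "\<dots> = (\<Sum>m\<in>{1..N}. 1 / real (totient m)) + (\<Sum>m\<in>{m\<in>M. m > N}. 1 / real (totient m))"
      using fin by (intro sum.union_disjoint) auto
    finally show ?thesis .
  qed
  also have "real N * \<dots> \<le> real N * (exp 4 * (1 + ln (real N)) + exp 4 * 2)"
  proof (intro mult_left_mono add_mono sum_inverse_totient_small[OF N]
      sum_inverse_totient_large[OF N])
    show "finite {m\<in>M. m > N}" using fin by simp
  qed (auto simp: M)
  also have "\<dots> = real N * (exp 4 * (3 + ln (real N)))" by (simp add: algebra_simps)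
  finally show ?thesis .
qed

theorem theorem2:
  shows "\<exists>C::real. C > 0 \<and>
    (\<forall>x::real. x \<ge> 2 \<longrightarrow>
      (\<Sum>n\<in>{n::nat. 1 \<le> n \<and> real n \<le> x}. real (card (Psi_star n))) \<le> C * x * ln x)"
proof (intro exI conjI allI impI)
  \<comment> \<open>The 7 arises from 3 \<le> 6 ln x, which holds because ln x \<ge> ln 2 \<ge>
    1/2.\<close>
  show "exp 4 * 7 > (0::real)" by simp
  fix x :: real assume x: "x \<ge> 2"
  define N where "N = nat \<lfloor>x\<rfloor>"
  have N: "N \<ge> 1" "real N \<le> x" using x by (auto simp: N_def le_nat_iff)
  have set: "{n::nat. 1 \<le> n \<and> real n \<le> x} = {1..N}"
    using x by (auto simp: N_def le_nat_floor) linarith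
  have "1 / 2 \<le> ln (2::real)"
    using ln_le_minus_one[of "1 / 2 :: real"] by (simp add: ln_div)
  also have "\<dots> \<le> ln x" using x by simp
  finally have lnx: "1 / 2 \<le> ln x" .
  have "(\<Sum>n\<in>{1..N}. real (card (Psi_star n))) \<le> real N * (exp 4 * (3 + ln (real N)))"
    by (rule sum_card_Psi_star_le[OF N(1)])
  also have "\<dots> \<le> x * (exp 4 * (7 * ln x))"
  proof (intro mult_mono order_refl)
    have "ln (real N) \<le> ln x" using N by simp
    then show "3 + ln (real N) \<le> 7 * ln x" using lnx by linarith
  qed (use N x in auto)
  finally show "(\<Sum>n\<in>{n::nat. 1 \<le> n \<and> real n \<le> x}. real (card (Psi_star n)))
      \<le> exp 4 * 7 * x * ln x"
    unfolding set by (simp only: mult_ac)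
qed

end
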